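(* Let $G$ be a finitely generated group and $H$ a group such that $\mathrm{Univ}(G)\supset\mathrm{Univ}(H)$. Then for every finite generating family $S=(s_1,\dots,s_n)$ of $G$, the marked group $(G,S)$ is a limit in $\mathcal{G}_n$ of marked subgroups of $H$, i.e. of marked groups $(H_i,S_i)\in\mathcal{G}_n$ where each $H_i$ is a subgroup of $H$.
   Context: A marked group $(G,S)$ is a group $G$ with an ordered finite generating family $S=(s_1,\dots,s_n)$ (repetitions allowed); two marked groups are identified if $s_i\mapsto s_i'$ extends to a group isomorphism. $\mathcal{G}_n$ is the set of groups marked by $n$ elements, identified with the set of normal subgroups of the free group $F_n=\langle e_1,\dots,e_n\rangle$ (kernel of $e_i\mapsto s_i$), with the topology induced by the product topology on $2^{F_n}$. $\mathrm{Univ}(G)$ is the set of universal sentences satisfied by $G$, a universal sentence being a first-order sentence of the form $\forall x_1\dots\forall x_p\,\phi(x_1,\dots,x_p)$ with $\phi$ quantifier-free in the language of groups $(\cdot,{}^{-1},1,=)$. *)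

theory Defs
  imports "HOL-Algebra.Generated_Groups" "HOL-Analysis.Function_Topology"
begin

section \<open>Free groups\<close>

text \<open>
  The free group on \<open>e\<^sub>0, \<dots>, e\<^sub>n\<^sub>-\<^sub>1\<close>, realised by reduced words. The letter \<open>(i, True)\<close> stands
  for \<open>e\<^sub>i\<close> and \<open>(i, False)\<close> for its inverse; generators are numbered from 0, as in \<open>S ! i\<close>.
\<close>

type_synonym word = "(nat \<times> bool) list"

definition inv_letter :: "nat \<times> bool \<Rightarrow> nat \<times> bool" where
  "inv_letter x = (fst x, \<not> snd x)"

fun reduced :: "word \<Rightarrow> bool" where
  "reduced [] \<longleftrightarrow> True"
| "reduced [x] \<longleftrightarrow> True"
| "reduced (x # y # w) \<longleftrightarrow> y \<noteq> inv_letter x \<and> reduced (y # w)"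

fun cons_red :: "nat \<times> bool \<Rightarrow> word \<Rightarrow> word" where
  "cons_red x [] = [x]"
| "cons_red x (y # w) = (if y = inv_letter x then w else x # y # w)"

definition reduce :: "word \<Rightarrow> word" where
  "reduce w = foldr cons_red w []"

definition free_group :: "nat \<Rightarrow> word monoid" where
  "free_group n = \<lparr>carrier = {w. fst ` set w \<subseteq> {..<n} \<and> reduced w},
                   mult = (\<lambda>u v. reduce (u @ v)), one = []\<rparr>"

text \<open>The homomorphism \<open>F\<^sub>n \<rightarrow> G\<close> extending \<open>e\<^sub>i \<mapsto> s\<^sub>i\<close>, for \<open>S = [s\<^sub>0, \<dots>, s\<^sub>n\<^sub>-\<^sub>1]\<close>.\<close>

definition word_val :: "('a, 'c) monoid_scheme \<Rightarrow> 'a list \<Rightarrow> word \<Rightarrow> 'a" where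
  "word_val G S w =
     foldr (\<lambda>(i, b) a. (if b then S ! i else inv\<^bsub>G\<^esub> (S ! i)) \<otimes>\<^bsub>G\<^esub> a) w \<one>\<^bsub>G\<^esub>"

lemma inv_letter_invol [simp]: "inv_letter (inv_letter x) = x"
  by (simp add: inv_letter_def)

lemma fst_inv_letter [simp]: "fst (inv_letter x) = fst x"
  by (simp add: inv_letter_def)

lemma inv_letter_neq [simp]: "inv_letter x \<noteq> x"
  by (simp add: inv_letter_def prod_eq_iff)

lemma reduced_Cons: "reduced (x # w) \<Longrightarrow> reduced w"
  by (cases w) auto

lemma reduced_cons_red: "reduced w \<Longrightarrow> reduced (cons_red x w)"
  by (cases w) (auto dest: reduced_Cons)

lemma cons_red_cancel: "reduced w \<Longrightarrow> cons_red x (cons_red (inv_letter x) w) = w"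
  by (cases w rule: reduced.cases) auto

lemma set_cons_red: "set (cons_red x w) \<subseteq> insert x (set w)"
  by (cases w) auto

lemma reduced_reduce: "reduced (reduce w)"
  by (induction w) (auto simp: reduce_def reduced_cons_red)

lemma set_reduce: "set (reduce w) \<subseteq> set w"
  unfolding reduce_def by (induction w) (auto dest!: set_cons_red[THEN subsetD])

lemma reduce_reduced: "reduced w \<Longrightarrow> reduce w = w"
proof (induction w)
  case (Cons x w)
  then have "reduce w = w" by (auto dest: reduced_Cons)
  then show ?case using Cons.prems by (cases w) (auto simp: reduce_def)
qed (simp add: reduce_def)

lemma reduced_foldr: "reduced v \<Longrightarrow> reduced (foldr cons_red u v)"
  by (induction u) (auto simp: reduced_cons_red)

lemma foldr_cons_red:
  assumes "reduced v" shows "foldr cons_red (cons_red x w) v = cons_red x (foldr cons_red w v)"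
proof (cases w)
  case (Cons y w')
  then show ?thesis using assms cons_red_cancel[OF reduced_foldr[OF assms], of x w'] by simp
qed simp

lemma foldr_reduce: "reduced v \<Longrightarrow> foldr cons_red (reduce u) v = foldr cons_red u v"
  by (induction u) (auto simp: reduce_def foldr_cons_red)

lemma reduce_append: "reduce (u @ v) = foldr cons_red u (reduce v)"
  by (simp add: reduce_def)

lemma reduce_inverse: "reduce (map inv_letter (rev w) @ w) = []"
proof (induction w)
  case (Cons x w)
  have "cons_red (inv_letter x) (cons_red x (reduce w)) = reduce w"
    using cons_red_cancel[OF reduced_reduce, of "inv_letter x"] by simp
  then show ?case using Cons by (simp add: reduce_def)
qed (simp add: reduce_def)

lemma group_free_group: "group (free_group n)"
proof (rule groupI)
  fix u v w assume "u \<in> carrier (free_group n)" "v \<in> carrier (free_group n)"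
    "w \<in> carrier (free_group n)"
  then show "u \<otimes>\<^bsub>free_group n\<^esub> v \<otimes>\<^bsub>free_group n\<^esub> w
      = u \<otimes>\<^bsub>free_group n\<^esub> (v \<otimes>\<^bsub>free_group n\<^esub> w)"
    using foldr_reduce[OF reduced_reduce, of "u @ v" w]
    by (simp add: free_group_def reduce_append reduce_reduced reduced_foldr reduced_reduce)
next
  fix w assume w: "w \<in> carrier (free_group n)"
  let ?v = "reduce (map inv_letter (rev w))"
  have "fst ` set ?v \<subseteq> fst ` set w"
    using image_mono[OF set_reduce, of fst "map inv_letter (rev w)"] by (simp add: image_image)
  then have "?v \<in> carrier (free_group n)"
    using w by (auto simp: free_group_def reduced_reduce)
  moreover have "reduce (?v @ w) = []"
    using foldr_reduce[OF reduced_reduce] reduce_inverse[of w] by (simp add: reduce_append)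
  ultimately show "\<exists>v\<in>carrier (free_group n). v \<otimes>\<^bsub>free_group n\<^esub> w = \<one>\<^bsub>free_group n\<^esub>"
    by (auto simp: free_group_def)
next
  fix u v assume "u \<in> carrier (free_group n)" "v \<in> carrier (free_group n)"
  then show "u \<otimes>\<^bsub>free_group n\<^esub> v \<in> carrier (free_group n)"
    using set_reduce[of "u @ v"] by (fastforce simp: free_group_def reduced_reduce)
qed (auto simp: free_group_def reduce_reduced)

lemma (in group) word_val_closed:
  "set S \<subseteq> carrier G \<Longrightarrow> fst ` set w \<subseteq> {..<length S} \<Longrightarrow> word_val G S w \<in> carrier G"
  by (induction w) (auto simp: word_val_def subset_iff)

lemma (in group) word_val_append:
  assumes S: "set S \<subseteq> carrier G"
    and "fst ` set u \<subseteq> {..<length S}" and v: "fst ` set v \<subseteq> {..<length S}"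
  shows "word_val G S (u @ v) = word_val G S u \<otimes> word_val G S v"
  using assms(2)
proof (induction u)
  case Nil
  then show ?case using word_val_closed[OF S v] by (simp add: word_val_def)
next
  case (Cons x u)
  then have "S ! fst x \<in> carrier G" using S by auto
  then show ?case
    using Cons word_val_closed[OF S v] word_val_closed[OF S, of u]
    by (auto simp: word_val_def m_assoc split: prod.splits)
qed

lemma (in group) word_val_cons_red:
  assumes S: "set S \<subseteq> carrier G" and w: "fst ` set (x # w) \<subseteq> {..<length S}"
  shows "word_val G S (cons_red x w) = word_val G S (x # w)"
proof (cases w)
  case (Cons y w')
  have "S ! fst x \<in> carrier G" "word_val G S w' \<in> carrier G"
    using S w Cons word_val_closed[OF S, of w'] by auto
  then show ?thesis
    using Cons by (auto simp: word_val_def inv_letter_def m_assoc[symmetric] split: prod.splits)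
qed simp

lemma (in group) word_val_reduce:
  assumes S: "set S \<subseteq> carrier G" and "fst ` set w \<subseteq> {..<length S}"
  shows "word_val G S (reduce w) = word_val G S w"
  using assms(2)
proof (induction w)
  case (Cons x w)
  have "fst ` set (x # reduce w) \<subseteq> {..<length S}"
    using Cons.prems set_reduce[of w] by fastforce
  from word_val_cons_red[OF S this]
  have "word_val G S (reduce (x # w)) = word_val G S (x # reduce w)"
    by (simp add: reduce_def)
  then show ?case using Cons by (auto simp: word_val_def split: prod.splits)
qed (simp add: reduce_def)

lemma (in group) word_val_hom:
  assumes "set S \<subseteq> carrier G"
  shows "word_val G S \<in> hom (free_group (length S)) G"
  using assms
  by (auto intro!: homI simp: free_group_def word_val_closed word_val_append word_val_reduce
      image_Un)

lemma (in group) word_val_generator: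
  "set S \<subseteq> carrier G \<Longrightarrow> i < length S \<Longrightarrow> word_val G S [(i, True)] = S ! i"
  by (auto simp: word_val_def subset_iff)


section \<open>Marked groups\<close>

definition finitely_generated :: "('a, 'c) monoid_scheme \<Rightarrow> bool" where
  "finitely_generated G \<longleftrightarrow> (\<exists>A. finite A \<and> A \<subseteq> carrier G \<and> generate G A = carrier G)"

definition marked_group :: "nat \<Rightarrow> ('a, 'c) monoid_scheme \<Rightarrow> 'a list \<Rightarrow> bool" where
  "marked_group n G S \<longleftrightarrow>
     group G \<and> length S = n \<and> set S \<subseteq> carrier G \<and> generate G (set S) = carrier G"

text \<open>The point of the space of marked groups (a normal subgroup of \<open>F\<^sub>n\<close>) given by \<open>(G, S)\<close>.\<close>

definition marked_point :: "('a, 'c) monoid_scheme \<Rightarrow> 'a list \<Rightarrow> word set" where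
  "marked_point G S = kernel (free_group (length S)) G (word_val G S)"

text \<open>
  \<open>pullback_topology A f T\<close> has underlying set \<open>A\<close> and the coarsest topology making \<open>f\<close>
  continuous. Here \<open>f\<close> sends a normal subgroup to its indicator function, an element of the
  product of copies of the discrete space \<open>bool\<close> indexed by \<open>F\<^sub>n\<close>.
\<close>

definition marked_groups :: "nat \<Rightarrow> word set topology" where
  "marked_groups n =
     pullback_topology {N. N \<lhd> free_group n} (\<lambda>N. \<lambda>w\<in>carrier (free_group n). w \<in> N)
       (product_topology (\<lambda>_. discrete_topology UNIV) (carrier (free_group n)))"

lemma topspace_marked_groups: "topspace (marked_groups n) = {N. N \<lhd> free_group n}"
  by (auto simp: marked_groups_def topspace_pullback_topology topspace_product_topology)

lemma marked_point_in_marked_groups: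
  assumes "marked_group n G S"
  shows "marked_point G S \<in> topspace (marked_groups n)"
proof -
  have "group_hom (free_group n) G (word_val G S)"
    using assms group.word_val_hom[of G S] group_free_group
    by (auto simp: marked_group_def group_hom_def group_hom_axioms_def)
  then show ?thesis
    using assms group_hom.normal_kernel
    by (auto simp: topspace_marked_groups marked_point_def marked_group_def)
qed


section \<open>Universal sentences in the language of groups\<close>

datatype gterm = Var nat | One | Mult gterm gterm | Inv gterm

datatype fm = Eq gterm gterm | Neg fm | Conj fm fm | Disj fm fm | Imp fm fm
  | Forall nat fm | Exists nat fm

primrec term_vars :: "gterm \<Rightarrow> nat set" where
  "term_vars (Var x) = {x}"
| "term_vars One = {}"
| "term_vars (Mult s t) = term_vars s \<union> term_vars t"
| "term_vars (Inv t) = term_vars t"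

primrec free_vars :: "fm \<Rightarrow> nat set" where
  "free_vars (Eq s t) = term_vars s \<union> term_vars t"
| "free_vars (Neg \<phi>) = free_vars \<phi>"
| "free_vars (Conj \<phi> \<psi>) = free_vars \<phi> \<union> free_vars \<psi>"
| "free_vars (Disj \<phi> \<psi>) = free_vars \<phi> \<union> free_vars \<psi>"
| "free_vars (Imp \<phi> \<psi>) = free_vars \<phi> \<union> free_vars \<psi>"
| "free_vars (Forall x \<phi>) = free_vars \<phi> - {x}"
| "free_vars (Exists x \<phi>) = free_vars \<phi> - {x}"

primrec quantifier_free :: "fm \<Rightarrow> bool" where
  "quantifier_free (Eq s t) \<longleftrightarrow> True"
| "quantifier_free (Neg \<phi>) \<longleftrightarrow> quantifier_free \<phi>"
| "quantifier_free (Conj \<phi> \<psi>) \<longleftrightarrow> quantifier_free \<phi> \<and> quantifier_free \<psi>"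
| "quantifier_free (Disj \<phi> \<psi>) \<longleftrightarrow> quantifier_free \<phi> \<and> quantifier_free \<psi>"
| "quantifier_free (Imp \<phi> \<psi>) \<longleftrightarrow> quantifier_free \<phi> \<and> quantifier_free \<psi>"
| "quantifier_free (Forall x \<phi>) \<longleftrightarrow> False"
| "quantifier_free (Exists x \<phi>) \<longleftrightarrow> False"

primrec term_val :: "('a, 'c) monoid_scheme \<Rightarrow> (nat \<Rightarrow> 'a) \<Rightarrow> gterm \<Rightarrow> 'a" where
  "term_val G \<sigma> (Var x) = \<sigma> x"
| "term_val G \<sigma> One = \<one>\<^bsub>G\<^esub>"
| "term_val G \<sigma> (Mult s t) = term_val G \<sigma> s \<otimes>\<^bsub>G\<^esub> term_val G \<sigma> t"
| "term_val G \<sigma> (Inv t) = inv\<^bsub>G\<^esub> (term_val G \<sigma> t)"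

primrec sat :: "('a, 'c) monoid_scheme \<Rightarrow> (nat \<Rightarrow> 'a) \<Rightarrow> fm \<Rightarrow> bool" where
  "sat G \<sigma> (Eq s t) \<longleftrightarrow> term_val G \<sigma> s = term_val G \<sigma> t"
| "sat G \<sigma> (Neg \<phi>) \<longleftrightarrow> \<not> sat G \<sigma> \<phi>"
| "sat G \<sigma> (Conj \<phi> \<psi>) \<longleftrightarrow> sat G \<sigma> \<phi> \<and> sat G \<sigma> \<psi>"
| "sat G \<sigma> (Disj \<phi> \<psi>) \<longleftrightarrow> sat G \<sigma> \<phi> \<or> sat G \<sigma> \<psi>"
| "sat G \<sigma> (Imp \<phi> \<psi>) \<longleftrightarrow> (sat G \<sigma> \<phi> \<longrightarrow> sat G \<sigma> \<psi>)"
| "sat G \<sigma> (Forall x \<phi>) \<longleftrightarrow> (\<forall>a\<in>carrier G. sat G (\<sigma>(x := a)) \<phi>)"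
| "sat G \<sigma> (Exists x \<phi>) \<longleftrightarrow> (\<exists>a\<in>carrier G. sat G (\<sigma>(x := a)) \<phi>)"

definition universal_sentence :: "fm \<Rightarrow> bool" where
  "universal_sentence \<psi> \<longleftrightarrow>
     free_vars \<psi> = {} \<and> (\<exists>xs \<phi>. quantifier_free \<phi> \<and> \<psi> = foldr Forall xs \<phi>)"

text \<open>For a sentence the choice of the assignment \<open>\<sigma>\<close> is irrelevant.\<close>

definition Univ :: "('a, 'c) monoid_scheme \<Rightarrow> fm set" where
  "Univ G = {\<psi>. universal_sentence \<psi> \<and> (\<forall>\<sigma>. range \<sigma> \<subseteq> carrier G \<longrightarrow> sat G \<sigma> \<psi>)}"

end

theory Submission
  imports Defs
begin

text \<open>
  For a finite set of words, the statement that no tuple of elements of \<open>H\<close> satisfies exactly those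
  relations among these words that \<open>S\<close> satisfies is a universal sentence. It fails in \<open>G\<close>, so it
  fails in \<open>H\<close>. Exhausting the free group by finite sets of words gives the approximating tuples.
\<close>

lemma free_vars_foldr_Forall: "free_vars (foldr Forall xs \<phi>) = free_vars \<phi> - set xs"
  by (induction xs) auto

text \<open>Assignments into the carrier already range over all values of every variable, so a
  prefix of universal quantifiers adds nothing to validity. For one quantifier, updating
  \<open>x\<close> to its own value gives one direction; the other holds because an update by an
  element of the carrier is again an assignment into the carrier.\<close>

lemma valid_foldr_Forall:
  "(\<forall>\<sigma>. range \<sigma> \<subseteq> carrier G \<longrightarrow> sat G \<sigma> (foldr Forall xs \<phi>)) \<longleftrightarrow>
   (\<forall>\<sigma>. range \<sigma> \<subseteq> carrier G \<longrightarrow> sat G \<sigma> \<phi>)"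
proof (induction xs)
  case (Cons x xs)
  have "(\<forall>\<sigma> :: nat \<Rightarrow> _. range \<sigma> \<subseteq> carrier G \<longrightarrow> (\<forall>a\<in>carrier G. sat G (\<sigma>(x := a)) \<psi>)) \<longleftrightarrow>
      (\<forall>\<sigma>. range \<sigma> \<subseteq> carrier G \<longrightarrow> sat G \<sigma> \<psi>)" for \<psi>
  proof (intro iffI allI impI ballI)
    fix \<sigma> :: "nat \<Rightarrow> _"
    assume "\<forall>\<sigma> :: nat \<Rightarrow> _. range \<sigma> \<subseteq> carrier G \<longrightarrow> (\<forall>a\<in>carrier G. sat G (\<sigma>(x := a)) \<psi>)"
      and "range \<sigma> \<subseteq> carrier G"
    then have "sat G (\<sigma>(x := \<sigma> x)) \<psi>" by blast
    then show "sat G \<sigma> \<psi>" by simp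
  next
    fix \<sigma> :: "nat \<Rightarrow> _" and a
    assume *: "\<forall>\<sigma>. range \<sigma> \<subseteq> carrier G \<longrightarrow> sat G \<sigma> \<psi>" "range \<sigma> \<subseteq> carrier G" "a \<in> carrier G"
    then have "range (\<sigma>(x := a)) \<subseteq> carrier G" by auto
    with * show "sat G (\<sigma>(x := a)) \<psi>" by blast
  qed
  then show ?case using Cons by simp
qed simp

text \<open>The nesting and the final \<open>One\<close> copy the fold in \<open>word_val\<close>,
  so that the values of term and word agree letter by letter.\<close>

definition word_term :: "word \<Rightarrow> gterm" where
  "word_term w = foldr (\<lambda>(i, b). Mult (if b then Var i else Inv (Var i))) w One"

lemma term_vars_word_term: "term_vars (word_term w) = fst ` set w"
  by (induction w) (auto simp: word_term_def split: prod.splits)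

lemma term_val_word_term:
  "fst ` set w \<subseteq> {..<n} \<Longrightarrow> term_val G \<sigma> (word_term w) = word_val G (map \<sigma> [0..<n]) w"
  by (induction w) (auto simp: word_term_def word_val_def split: prod.splits)

text \<open>A finite piece of the atomic diagram. Membership in \<open>N\<close> is decided while
  the formula is built, so \<open>N\<close> itself does not occur in it; \<open>Eq One One\<close>
  serves as the empty conjunction.\<close>

definition diagram :: "word set \<Rightarrow> word list \<Rightarrow> fm" where
  "diagram N ws =
     foldr (\<lambda>w. Conj (let e = Eq (word_term w) One in if w \<in> N then e else Neg e)) ws (Eq One One)"

lemma quantifier_free_diagram: "quantifier_free (diagram N ws)"
  by (induction ws) (auto simp: diagram_def Let_def)

lemma free_vars_diagram: "free_vars (diagram N ws) = (\<Union>w\<in>set ws. fst ` set w)"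
  by (induction ws) (auto simp: diagram_def Let_def term_vars_word_term)

lemma sat_diagram:
  "sat G \<sigma> (diagram N ws) \<longleftrightarrow>
   (\<forall>w\<in>set ws. term_val G \<sigma> (word_term w) = \<one>\<^bsub>G\<^esub> \<longleftrightarrow> w \<in> N)"
  by (induction ws) (auto simp: diagram_def Let_def)

lemma marked_point_iff:
  "w \<in> marked_point G S \<longleftrightarrow> w \<in> carrier (free_group (length S)) \<and> word_val G S w = \<one>\<^bsub>G\<^esub>"
  by (simp add: marked_point_def kernel_def)

lemma Univ_subset_realize_relations:
  assumes "group G" and "Univ H \<subseteq> Univ G" and S: "set S \<subseteq> carrier G"
    and ws: "set ws \<subseteq> carrier (free_group (length S))"
  obtains T where "length T = length S" and "set T \<subseteq> carrier H"
    and "\<And>w. w \<in> set ws \<Longrightarrow> w \<in> marked_point H T \<longleftrightarrow> w \<in> marked_point G S"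
proof -
  define n where "n = length S"
  define \<phi> where "\<phi> = diagram (marked_point G S) ws"
  \<comment> \<open>The letters of the words are numbered below \<open>n\<close>, so this prefix
    binds every variable of \<open>\<phi>\<close>.\<close>
  define \<psi> where "\<psi> = foldr Forall [0..<n] (Neg \<phi>)"
  \<comment> \<open>Beyond the generators the unit is a default value that keeps the assignment
    inside the carrier.\<close>
  define \<sigma> where "\<sigma> i = (if i < n then S ! i else \<one>\<^bsub>G\<^esub>)" for i
  have fst_ws: "fst ` set w \<subseteq> {..<n}" if "w \<in> set ws" for w
    using that ws by (auto simp: free_group_def n_def)
  have "free_vars \<phi> \<subseteq> {..<n}"
    unfolding \<phi>_def free_vars_diagram using fst_ws by (intro UN_least)
  then have universal: "universal_sentence \<psi>"
    unfolding universal_sentence_def \<psi>_def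
    by (intro conjI exI[of _ "[0..<n]"] exI[of _ "Neg \<phi>"])
       (auto simp: free_vars_foldr_Forall \<phi>_def quantifier_free_diagram)
  interpret G: group G by fact
  have \<sigma>: "range \<sigma> \<subseteq> carrier G" "map \<sigma> [0..<n] = S"
    using S by (auto simp: \<sigma>_def n_def intro!: nth_equalityI)
  then have "sat G \<sigma> \<phi>"
    using ws fst_ws term_val_word_term[of _ n G \<sigma>]
    by (auto simp: \<phi>_def sat_diagram marked_point_iff)
  with \<sigma>(1) have "\<psi> \<notin> Univ G"
    unfolding Univ_def \<psi>_def valid_foldr_Forall mem_Collect_eq by auto
  with assms(2) have "\<psi> \<notin> Univ H" by blast
  \<comment> \<open>As \<open>\<psi>\<close> has the required syntactic form, it can be missing from
    \<open>Univ H\<close> only because some assignment violates \<open>Neg \<phi>\<close>.\<close>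
  with universal obtain \<tau> where \<tau>: "range \<tau> \<subseteq> carrier H" "sat H \<tau> \<phi>"
    unfolding Univ_def \<psi>_def valid_foldr_Forall mem_Collect_eq by auto
  show thesis
  proof (rule that)
    show "length (map \<tau> [0..<n]) = length S" by (simp add: n_def)
    show "set (map \<tau> [0..<n]) \<subseteq> carrier H" using \<tau> by auto
    show "w \<in> marked_point H (map \<tau> [0..<n]) \<longleftrightarrow> w \<in> marked_point G S" if "w \<in> set ws" for w
      using that ws fst_ws \<tau>(2) term_val_word_term[of w n H \<tau>]
      by (auto simp: \<phi>_def sat_diagram marked_point_iff[of w H] n_def)
  qed
qed

context group
begin

text \<open>Restricting the carrier keeps multiplication and unit as they are, but
  \<open>inv\<close> is defined through the carrier; inverses agree because \<open>K\<close> is a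
  subgroup.\<close>

lemma word_val_subgroup:
  assumes "subgroup K G" and "set S \<subseteq> K" and "fst ` set w \<subseteq> {..<length S}"
  shows "word_val (G\<lparr>carrier := K\<rparr>) S w = word_val G S w"
  using assms(3)
proof (induction w)
  case (Cons x w)
  then have "S ! fst x \<in> K" using assms(2) by auto
  then show ?case
    using Cons m_inv_consistent[OF assms(1)] by (auto simp: word_val_def split: prod.splits)
qed (simp add: word_val_def)

text \<open>Relations of a marked subgroup can thus be tested in the ambient group, where the
  universal sentences are evaluated.\<close>

lemma marked_point_subgroup:
  assumes "subgroup K G" and "set S \<subseteq> K"
  shows "marked_point (G\<lparr>carrier := K\<rparr>) S = marked_point G S"
  using word_val_subgroup[OF assms] by (auto simp: marked_point_iff free_group_def)

lemma marked_group_generate: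
  assumes "set S \<subseteq> carrier G"
  shows "marked_group (length S) (G\<lparr>carrier := generate G (set S)\<rparr>) S"
proof -
  have K: "set S \<subseteq> generate G (set S)" by (auto intro: generate.incl)
  then show ?thesis
    using generate_is_subgroup[OF assms] generate_consistent[OF K]
    by (simp add: marked_group_def subgroup.subgroup_is_group is_group)
qed

end

text \<open>Convergence in the pullback topology is convergence of indicator functions in the
  product, hence coordinatewise; in a discrete coordinate it suffices that the value is eventually
  that of the limit.\<close>

lemma limitin_marked_groups:
  assumes N: "N \<lhd> free_group n" and M: "\<And>i. M i \<lhd> free_group n"
    and ev: "\<And>w. w \<in> carrier (free_group n) \<Longrightarrow> \<forall>\<^sub>F i in F. w \<in> M i \<longleftrightarrow> w \<in> N"
  shows "limitin (marked_groups n) M N F"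
proof -
  let ?f = "\<lambda>N. \<lambda>w\<in>carrier (free_group n). w \<in> N"
  have "limitin (product_topology (\<lambda>_. discrete_topology UNIV) (carrier (free_group n)))
      (\<lambda>i. ?f (M i)) (?f N) F"
    unfolding limitin_componentwise
  proof (intro conjI ballI)
    fix w assume w: "w \<in> carrier (free_group n)"
    show "limitin (discrete_topology UNIV) (\<lambda>i. ?f (M i) w) (?f N w) F"
      using ev[OF w] w by (auto simp: limitin_def elim: eventually_mono)
  qed auto
  then show ?thesis
    using N M
    by (auto simp: limitin_def topspace_marked_groups marked_groups_def
        topspace_pullback_topology openin_pullback_topology elim: eventually_mono)
qed

theorem proposition5p3:
  fixes G :: "('a, 'c) monoid_scheme" and H :: "('b, 'd) monoid_scheme"
  assumes "group G" and "finitely_generated G" and "group H"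
    and "Univ H \<subseteq> Univ G"
  shows "\<forall>n S. marked_group n G S \<longrightarrow>
    (\<exists>(K :: nat \<Rightarrow> 'b set) (T :: nat \<Rightarrow> 'b list).
       (\<forall>i. subgroup (K i) H \<and> marked_group n (H\<lparr>carrier := K i\<rparr>) (T i)) \<and>
       limitin (marked_groups n) (\<lambda>i. marked_point (H\<lparr>carrier := K i\<rparr>) (T i))
         (marked_point G S) sequentially)"
proof (intro allI impI)
  fix n S assume S: "marked_group n G S"
  then have n: "n = length S" and "set S \<subseteq> carrier G"
    by (auto simp: marked_group_def)
  interpret H: group H by fact
  let ?F = "carrier (free_group n)"
  \<comment> \<open>Words are countable: the sets cut out by \<open>to_nat w \<le> i\<close> are
    finite, increase with \<open>i\<close> and exhaust the free group.\<close>
  have "\<exists>T. length T = n \<and> set T \<subseteq> carrier H \<and>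
      (\<forall>w\<in>?F. to_nat w \<le> i \<longrightarrow> (w \<in> marked_point H T \<longleftrightarrow> w \<in> marked_point G S))" for i
  proof -
    have "{w \<in> ?F. to_nat w \<le> i} \<subseteq> from_nat ` {..i}"
      by (force simp: image_iff intro: from_nat_to_nat[symmetric])
    then have "finite {w \<in> ?F. to_nat w \<le> i}" by (rule finite_subset) simp
    then obtain ws where "set ws = {w \<in> ?F. to_nat w \<le> i}" by (metis finite_list)
    then show ?thesis
      using Univ_subset_realize_relations[OF assms(1,4) \<open>set S \<subseteq> carrier G\<close>, of ws]
      unfolding n by (metis (no_types, lifting) mem_Collect_eq subsetI)
  qed
  then obtain T where len: "\<And>i. length (T i) = n" and T: "\<And>i. set (T i) \<subseteq> carrier H"
    and eq: "\<And>i w. w \<in> ?F \<Longrightarrow> to_nat w \<le> i \<Longrightarrow> w \<in> marked_point H (T i) \<longleftrightarrow> w \<in> marked_point G S"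
    by metis
  \<comment> \<open>The tuple found in \<open>H\<close> need not generate \<open>H\<close>, so it
    marks the subgroup that it generates.\<close>
  define K where "K i = generate H (set (T i))" for i
  have K: "subgroup (K i) H" "set (T i) \<subseteq> K i" for i
    using H.generate_is_subgroup[OF T] by (auto simp: K_def generate.incl)
  have marked: "marked_group n (H\<lparr>carrier := K i\<rparr>) (T i)" for i
    using H.marked_group_generate[OF T] len by (simp add: K_def)
  have "limitin (marked_groups n) (\<lambda>i. marked_point (H\<lparr>carrier := K i\<rparr>) (T i))
      (marked_point G S) sequentially"
  proof (rule limitin_marked_groups)
    show "marked_point G S \<lhd> free_group n"
      "marked_point (H\<lparr>carrier := K i\<rparr>) (T i) \<lhd> free_group n" for i
      using marked_point_in_marked_groups[OF S] marked_point_in_marked_groups[OF marked]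
      by (simp_all add: topspace_marked_groups)
    show "\<forall>\<^sub>F i in sequentially.
        w \<in> marked_point (H\<lparr>carrier := K i\<rparr>) (T i) \<longleftrightarrow> w \<in> marked_point G S" if "w \<in> ?F" for w
      \<comment> \<open>From stage \<open>to_nat w\<close> on, \<open>w\<close> is among the words
        whose status is prescribed.\<close>
      using eventually_ge_at_top[of "to_nat w"]
      by eventually_elim (simp add: H.marked_point_subgroup[OF K] eq that)
  qed
  with K(1) marked show "\<exists>K T. (\<forall>i. subgroup (K i) H \<and> marked_group n (H\<lparr>carrier := K i\<rparr>) (T i)) \<and>
      limitin (marked_groups n) (\<lambda>i. marked_point (H\<lparr>carrier := K i\<rparr>) (T i))
        (marked_point G S) sequentially"
    by blast
qed

end
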